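(* For all integers $n\ge 1$ and $k\ge 0$, the over-Mahonian number $i_{B'}(n,k)$ is the cardinality of the set of tilings $\mathcal{T}^{B'}_{n,k}$, that is, $$i_{B'}(n,k)=|\mathcal{T}^{B'}_{n,k}|.$$
   Context: For $n\ge 1$, $B'_n$ denotes the set of overlined permutations of $\{1,\dots,n\}$ of the following kind: an element is a permutation $\sigma=\sigma_1\sigma_2\cdots\sigma_n$ of $\{1,\dots,n\}$ (in one-line notation) in which each entry $\sigma_i$ is independently either overlined or not overlined, subject to the condition that $\sigma_i$ may be overlined only if there is an index $j>i$ with $\sigma_i>\sigma_j$ (overlines are ignored in comparing entries). An inversion of such an element is a pair of positions $i<j$ with $\sigma_i>\sigma_j$, again ignoring overlines. The over-Mahonian number $i_{B'}(n,k)$ is the number of elements of $B'_n$ with exactly $k$ inversions; it is $0$ for integers $k$ outside $0\le k\le\binom n2$. $\mathcal{T}^{B'}_{n,k}$ is the set of all tilings of a $1\times(n+k-1)$ board, read from left to right, by blue squares (length 1), red squares (length 1) and black rectangles (length 2), such that: the tiling uses at most $n-1$ blue squares and at most $k$ red squares; the total number of red squares and black rectangles is exactly $k$; the total number of blue squares and black rectangles is exactly $n-1$; and, for each maximal run of consecutive red squares, if $j$ denotes the total number of blue squares and black rectangles to the left of the run (a black rectangle being treated as equivalent to one blue square followed by one red square, so counting as one blue square), then the run has length at most $j$ if the tile immediately before it is a blue square, and at most $j-1$ if the tile immediately before it is a black rectangle. In particular no red square may be the first tile. *)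

theory Defs
  imports "HOL-Combinatorics.Multiset_Permutations"
begin

text \<open>An overlined word is a list of pairs (entry, flag), where the flag is \<open>True\<close>
  iff the entry is overlined. List positions are counted from 0.\<close>

definition over_perms :: "nat \<Rightarrow> (nat \<times> bool) list set" where
  "over_perms n = {w. map fst w \<in> permutations_of_set {1..n} \<and>
     (\<forall>i<length w. snd (w ! i) \<longrightarrow> (\<exists>j<length w. i < j \<and> fst (w ! i) > fst (w ! j)))}"

definition inversions :: "(nat \<times> bool) list \<Rightarrow> (nat \<times> nat) set" where
  "inversions w = {(i, j). i < j \<and> j < length w \<and> fst (w ! i) > fst (w ! j)}"

definition over_mahonian :: "nat \<Rightarrow> nat \<Rightarrow> nat" where
  "over_mahonian n k = card {w \<in> over_perms n. card (inversions w) = k}"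

datatype tile = Blue | Red | Black

fun tile_length :: "tile \<Rightarrow> nat" where
  "tile_length Blue = 1"
| "tile_length Red = 1"
| "tile_length Black = 2"

text \<open>The maximal runs of red squares of \<open>ts\<close> are the decompositions
  \<open>ts = us @ replicate r Red @ vs\<close> with \<open>r > 0\<close> in which \<open>us\<close> does not end and \<open>vs\<close>
  does not start with a red square. The conjunct \<open>us \<noteq> []\<close> says that the tiling does not
  start with a red square. If \<open>last us = Black\<close> then \<open>j \<ge> 1\<close>, so the subtraction is not
  truncated.\<close>

definition red_runs_ok :: "tile list \<Rightarrow> bool" where
  "red_runs_ok ts \<longleftrightarrow>
     (\<forall>us r vs. ts = us @ replicate r Red @ vs \<and> r > 0 \<and>
        (us = [] \<or> last us \<noteq> Red) \<and> (vs = [] \<or> hd vs \<noteq> Red) \<longrightarrow>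
        (let j = count_list us Blue + count_list us Black in
           us \<noteq> [] \<and>
           (last us = Blue \<longrightarrow> r \<le> j) \<and>
           (last us = Black \<longrightarrow> r \<le> j - 1)))"

text \<open>Intended for \<open>n \<ge> 1\<close> only.\<close>

definition tilings :: "nat \<Rightarrow> nat \<Rightarrow> tile list set" where
  "tilings n k = {ts.
     sum_list (map tile_length ts) = n + k - 1 \<and>
     count_list ts Blue \<le> n - 1 \<and>
     count_list ts Red \<le> k \<and>
     count_list ts Red + count_list ts Black = k \<and>
     count_list ts Blue + count_list ts Black = n - 1 \<and>
     red_runs_ok ts}"

lemma finite_over_perms: "finite (over_perms n)"
proof (rule finite_subset)
  show "over_perms n \<subseteq> {w. set w \<subseteq> {1..n} \<times> UNIV \<and> length w = n}"
  proof
    fix w assume "w \<in> over_perms n"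
    then have p: "map fst w \<in> permutations_of_set {1..n}"
      by (simp add: over_perms_def)
    have len: "length w = n"
      using length_finite_permutations_of_set[OF p] by simp
    have "fst ` set w = {1..n}"
      using permutations_of_setD(1)[OF p] by simp
    then have "set w \<subseteq> {1..n} \<times> UNIV"
      by (metis imageI mem_Times_iff UNIV_I subsetI)
    with len show "w \<in> {w. set w \<subseteq> {1..n} \<times> UNIV \<and> length w = n}"
      by simp
  qed
  show "finite {w. set w \<subseteq> {1..n} \<times> (UNIV :: bool set) \<and> length w = n}"
    by (intro finite_lists_length_eq finite_cartesian_product) auto
qed

lemma finite_tilings: "finite (tilings n k)"
proof (rule finite_subset)
  have len: "length ts \<le> sum_list (map tile_length ts)" for ts
  proof (induction ts)
    case (Cons t ts)
    then show ?case by (cases t) auto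
  qed simp
  have "set ts \<subseteq> {Blue, Red, Black}" for ts
    using tile.exhaust by blast
  with len show "tilings n k \<subseteq> {ts. set ts \<subseteq> {Blue, Red, Black} \<and> length ts \<le> n + k - 1}"
    unfolding tilings_def by (smt (verit) mem_Collect_eq subsetI)
  show "finite {ts. set ts \<subseteq> {Blue, Red, Black} \<and> length ts \<le> n + k - 1}"
    by (rule finite_lists_length_le) simp
qed

end

theory Submission imports Defs begin

text \<open>
  Both sides count sequences of independent choices, and the choices are the same. The first
  letter of an overlined permutation of an \<open>Suc m\<close>-element set exceeds \<open>c \<le> m\<close> of the later
  letters, contributes exactly \<open>c\<close> inversions, and may be overlined iff \<open>c > 0\<close>; the rest is an
  arbitrary overlined permutation of the remaining \<open>m\<close> letters. On the other side, a tiling ends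
  with a block made of its last non-red tile and the red squares after it. If \<open>m\<close> blue squares
  and black rectangles occur in total, the block is a blue square with \<open>c \<le> m\<close> red squares, or a
  black rectangle with \<open>c - 1 \<le> m - 1\<close> red squares where \<open>c > 0\<close>. Either way it contributes \<open>c\<close>
  to the number of red squares and black rectangles, and what precedes it is an arbitrary
  admissible tiling. So the choices on both sides are the pairs \<open>(c, b)\<close> with \<open>c \<le> m\<close>, where the
  flag \<open>b\<close> (overlined, or black) may be set only if \<open>c > 0\<close>. Overline corresponds to black.

  The two decompositions, \<open>over_words_decompose\<close> and \<open>tilings_decompose\<close>, therefore give the same
  recurrence. Removing the first letter leaves a permutation of a set other than an initial
  interval, so on that side the count is carried out for all finite sets of numbers; it
  depends only on the size of the set.
\<close>

definition choices :: "nat \<Rightarrow> nat \<Rightarrow> (nat \<times> bool) set" where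
  "choices m k = {(c, b). c \<le> m \<and> c \<le> k \<and> (b \<longrightarrow> c > 0)}"

lemma finite_choices: "finite (choices m k)"
  by (rule finite_subset[of _ "{..m} \<times> UNIV"]) (auto simp: choices_def)


section \<open>Overlined permutations of a finite set\<close>

definition overlines_ok :: "(nat \<times> bool) list \<Rightarrow> bool" where
  "overlines_ok w \<longleftrightarrow>
     (\<forall>i<length w. snd (w ! i) \<longrightarrow> (\<exists>j<length w. i < j \<and> fst (w ! i) > fst (w ! j)))"

definition over_words :: "nat set \<Rightarrow> nat \<Rightarrow> (nat \<times> bool) list set" where
  "over_words A k =
     {w. map fst w \<in> permutations_of_set A \<and> overlines_ok w \<and> card (inversions w) = k}"

definition rank :: "nat set \<Rightarrow> nat \<Rightarrow> nat" where
  "rank A a = card {x \<in> A. x < a}"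

lemma over_mahonian_eq: "over_mahonian n k = card (over_words {1..n} k)"
  by (simp add: over_mahonian_def over_perms_def over_words_def overlines_ok_def conj_assoc)

lemma overlines_ok_Nil [simp]: "overlines_ok []"
  by (simp add: overlines_ok_def)

lemma inversions_Nil [simp]: "inversions [] = {}"
  by (simp add: inversions_def)

lemma over_words_empty: "over_words {} k = (if k = 0 then {[]} else {})"
  by (auto simp: over_words_def)

lemma overlines_ok_Cons:
  "overlines_ok ((a, b) # w) \<longleftrightarrow> (b \<longrightarrow> (\<exists>x\<in>set (map fst w). x < a)) \<and> overlines_ok w"
proof -
  have "(\<exists>x\<in>set (map fst w). x < a) \<longleftrightarrow> (\<exists>j<length w. fst (w ! j) < a)"
    by (metis in_set_conv_nth length_map nth_map)
  then show ?thesis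
    by (simp add: overlines_ok_def All_less_Suc2 Ex_less_Suc2)
qed

lemma finite_inversions: "finite (inversions w)"
  by (rule finite_subset[of _ "{..<length w} \<times> {..<length w}"]) (auto simp: inversions_def)

lemma card_inversions_Cons:
  assumes "distinct (map fst w)"
  shows "card (inversions ((a, b) # w)) = rank (set (map fst w)) a + card (inversions w)"
proof -
  let ?J = "{j. j < length w \<and> fst (w ! j) < a}"
  have eq: "inversions ((a, b) # w) =
      (\<lambda>j. (0, Suc j)) ` ?J \<union> map_prod Suc Suc ` inversions w" (is "?L = ?P \<union> ?Q")
  proof
    show "?L \<subseteq> ?P \<union> ?Q"
    proof
      fix p assume "p \<in> ?L"
      then obtain i j where p: "p = (i, j)" "i < j" "j < length ((a, b) # w)"
          "fst (((a, b) # w) ! i) > fst (((a, b) # w) ! j)"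
        by (auto simp: inversions_def)
      then obtain j' where "j = Suc j'"
        by (cases j) auto
      with p show "p \<in> ?P \<union> ?Q"
        by (cases i) (auto simp: inversions_def)
    qed
    show "?P \<union> ?Q \<subseteq> ?L"
      by (auto simp: inversions_def)
  qed
  have inj: "inj_on (\<lambda>j. fst (w ! j)) ?J"
    using assms by (auto simp: inj_on_def distinct_conv_nth)
  have image: "(\<lambda>j. fst (w ! j)) ` ?J = {x \<in> set (map fst w). x < a}"
    using in_set_conv_nth[of _ "map fst w"] by (auto simp del: set_map)
  have "card ?J = rank (set (map fst w)) a"
    unfolding rank_def image[symmetric] by (rule card_image[OF inj, symmetric])
  moreover have "card (?P \<union> ?Q) = card ?P + card ?Q"
    by (rule card_Un_disjoint) (auto simp: finite_inversions)
  moreover have "card ?P = card ?J"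
    by (rule card_image) (auto simp: inj_on_def)
  moreover have "card ?Q = card (inversions w)"
    by (rule card_image) (auto simp: inj_on_def)
  ultimately show ?thesis
    by (simp add: eq)
qed

lemma over_words_Cons:
  assumes "finite A"
  shows "(a, b) # w \<in> over_words A k \<longleftrightarrow>
    a \<in> A \<and> (b \<longrightarrow> rank A a > 0) \<and> rank A a \<le> k \<and> w \<in> over_words (A - {a}) (k - rank A a)"
proof -
  have rank: "rank (A - {a}) a = rank A a"
    unfolding rank_def by (rule arg_cong[where f = card]) auto
  have pos: "rank A a > 0 \<longleftrightarrow> (\<exists>x\<in>A - {a}. x < a)"
    using assms by (auto simp: rank_def card_gt_0_iff)
  have "map fst ((a, b) # w) \<in> permutations_of_set A \<longleftrightarrow>
      a \<in> A \<and> map fst w \<in> permutations_of_set (A - {a})"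
    by (auto simp: permutations_of_set_def)
  moreover have "overlines_ok ((a, b) # w) \<longleftrightarrow> (b \<longrightarrow> rank A a > 0) \<and> overlines_ok w"
    and "card (inversions ((a, b) # w)) = rank A a + card (inversions w)"
    if "map fst w \<in> permutations_of_set (A - {a})"
    using permutations_of_setD[OF that] card_inversions_Cons[of w a b]
    by (auto simp: overlines_ok_Cons pos rank simp del: set_map)
  ultimately show ?thesis
    unfolding over_words_def by auto
qed

text \<open>Ranks enumerate the elements of \<open>A\<close> in increasing order, so the first letter of a
  permutation of \<open>A\<close> may be replaced by its rank when choices are counted.\<close>

lemma bij_betw_rank:
  assumes "finite A"
  shows "bij_betw (rank A) A {..<card A}"
proof -
  have less: "rank A a < rank A b" if "a \<in> A" "a < b" for a b
    unfolding rank_def by (rule psubset_card_mono) (use assms that in auto)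
  have inj: "inj_on (rank A) A"
    by (rule linorder_inj_onI') (use less in force)
  moreover have "rank A a < card A" if "a \<in> A" for a
    unfolding rank_def by (rule psubset_card_mono) (use assms that in auto)
  then have "rank A ` A = {..<card A}"
    by (intro card_subset_eq) (auto simp: card_image[OF inj])
  ultimately show ?thesis
    by (simp add: bij_betw_def)
qed

lemma over_words_decompose:
  assumes "finite A" "A \<noteq> {}"
  shows "over_words A k = (\<lambda>(p, w). p # w) `
    (SIGMA p : {(a, b). a \<in> A \<and> (rank A a, b) \<in> choices (card A - 1) k}.
       over_words (A - {fst p}) (k - rank A (fst p)))" (is "_ = _ ` ?S")
proof -
  have bound: "rank A a \<le> card A - 1" if "a \<in> A" for a
    using bij_betwE[OF bij_betw_rank[OF assms(1)]] that by fastforce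
  have "[] \<notin> over_words A k"
    using assms(2) by (auto simp: over_words_def permutations_of_set_def)
  moreover have "(a, b) # w \<in> over_words A k \<longleftrightarrow> ((a, b), w) \<in> ?S" for a b w
    using bound by (auto simp: over_words_Cons[OF assms(1)] choices_def)
  ultimately have "x \<in> over_words A k \<longleftrightarrow> x \<in> (\<lambda>(p, w). p # w) ` ?S" for x
    by (cases x) (auto simp: image_iff split: prod.splits)
  then show ?thesis
    by blast
qed

lemma finite_over_words: "finite A \<Longrightarrow> finite (over_words A k)"
proof (induction "card A" arbitrary: A k)
  case 0
  then show ?case by (simp add: over_words_empty)
next
  case (Suc m)
  have "A \<noteq> {}"
    using Suc.hyps by auto
  have "{(a, b). a \<in> A \<and> (rank A a, b) \<in> choices (card A - 1) k} \<subseteq> A \<times> UNIV"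
    by auto
  then have "finite {(a, b). a \<in> A \<and> (rank A a, b) \<in> choices (card A - 1) k}"
    by (rule finite_subset) (use Suc.prems in simp)
  moreover have "finite (over_words (A - {a}) l)" if "a \<in> A" for a l
    using Suc.hyps Suc.prems that by (intro Suc.hyps(1)) auto
  ultimately show ?case
    unfolding over_words_decompose[OF Suc.prems \<open>A \<noteq> {}\<close>]
    by (intro finite_imageI finite_SigmaI) auto
qed

lemma card_over_words_recurrence:
  assumes A: "finite A" "card A = Suc m"
    and T: "\<And>B l. finite B \<Longrightarrow> card B = m \<Longrightarrow> card (over_words B l) = T l"
  shows "card (over_words A k) = (\<Sum>(c, b)\<in>choices m k. T (k - c))"
proof -
  let ?I = "{(a, b). a \<in> A \<and> (rank A a, b) \<in> choices (card A - 1) k}"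
  have "A \<noteq> {}"
    using A by auto
  have "finite ?I"
    by (rule finite_subset[of _ "A \<times> UNIV"]) (use A in auto)
  have inj: "inj_on (\<lambda>(p, w). p # w) S" for S :: "((nat \<times> bool) \<times> (nat \<times> bool) list) set"
    by (auto simp: inj_on_def)
  have "card (over_words A k) =
      (\<Sum>p\<in>?I. card (over_words (A - {fst p}) (k - rank A (fst p))))"
    unfolding over_words_decompose[OF A(1) \<open>A \<noteq> {}\<close>] card_image[OF inj]
    by (rule card_SigmaI) (use \<open>finite ?I\<close> A in \<open>auto intro: finite_over_words\<close>)
  also have "\<dots> = (\<Sum>p\<in>?I. T (k - rank A (fst p)))"
    by (intro sum.cong refl T) (use A in auto)
  also have "\<dots> = (\<Sum>p\<in>?I. (\<lambda>(c, b). T (k - c)) (map_prod (rank A) id p))"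
    by (intro sum.cong) auto
  also have "\<dots> = (\<Sum>(c, b)\<in>choices m k. T (k - c))"
  proof (rule sum.reindex_bij_betw)
    have rank: "inj_on (rank A) A" "rank A ` A = {..m}"
      using bij_betw_rank[OF A(1)] A(2) by (auto simp: bij_betw_def lessThan_Suc_atMost)
    have "inj_on (map_prod (rank A) id) ?I"
      using rank(1) by (auto simp: inj_on_def)
    moreover have "map_prod (rank A) id ` ?I = choices m k"
    proof
      show "map_prod (rank A) id ` ?I \<subseteq> choices m k"
        using A(2) by auto
      show "choices m k \<subseteq> map_prod (rank A) id ` ?I"
      proof
        fix p assume p: "p \<in> choices m k"
        then have "fst p \<in> rank A ` A"
          unfolding rank(2) by (auto simp: choices_def)
        then obtain a where "a \<in> A" "fst p = rank A a"
          by auto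
        moreover from this p have "(rank A a, snd p) \<in> choices m k"
          by (metis prod.collapse)
        ultimately show "p \<in> map_prod (rank A) id ` ?I"
          by (intro image_eqI[of _ _ "(a, snd p)"]) (auto simp: prod_eq_iff A(2))
      qed
    qed
    ultimately show "bij_betw (map_prod (rank A) id) ?I (choices m k)"
      by (simp add: bij_betw_def)
  qed
  finally show ?thesis .
qed


section \<open>Splitting off the last block of a tiling\<close>

text \<open>A black rectangle already accounts for one unit of \<open>c\<close>, hence the \<open>c - 1\<close>.\<close>

fun block :: "nat \<times> bool \<Rightarrow> tile list" where
  "block (c, b) = (if b then Black # replicate (c - 1) Red else Blue # replicate c Red)"

lemma last_block_exists:
  "ts = replicate (length ts) Red \<or> (\<exists>us t r. t \<noteq> Red \<and> ts = us @ t # replicate r Red)"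
proof (induction ts)
  case (Cons x ts)
  then show ?case
    by (metis append_Cons append_Nil length_Cons replicate_Suc)
qed simp

lemma last_block_unique:
  assumes "us @ t # replicate r Red = us' @ t' # replicate r' Red" "t \<noteq> Red" "t' \<noteq> Red"
  shows "us = us' \<and> t = t' \<and> r = r'"
proof -
  have "takeWhile (\<lambda>x. x = Red) (rev (vs @ x # replicate q Red)) = replicate q Red"
    if "x \<noteq> Red" for vs x q
    using that by (simp add: takeWhile_append)
  from this[of t us r] this[of t' us' r'] have "r = r'"
    using assms by (metis length_replicate)
  then show ?thesis
    using assms(1) by simp
qed

text \<open>A non-red tile cuts off the red squares after it from everything before, so the maximal
  runs of the extended tiling are those of \<open>ts\<close> and at most one more, at the very end. The tile
  \<open>t\<close> itself counts among those to the left of that last run, hence \<open>Suc j\<close> and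
  \<open>j = Suc j - 1\<close> as bounds.\<close>

lemma red_runs_ok_append:
  assumes t: "t \<noteq> Red"
  shows "red_runs_ok (ts @ t # replicate r Red) \<longleftrightarrow>
    red_runs_ok ts \<and>
    (let j = count_list ts Blue + count_list ts Black in
       r \<le> (if t = Blue then Suc j else j))"
    (is "red_runs_ok ?new \<longleftrightarrow> _ \<and> ?bound")
proof (intro iffI conjI)
  assume new: "red_runs_ok ?new"
  show "red_runs_ok ts"
    unfolding red_runs_ok_def
  proof (intro allI impI, elim conjE)
    fix us q vs
    assume "ts = us @ replicate q Red @ vs" "q > 0" "us = [] \<or> last us \<noteq> Red"
      "vs = [] \<or> hd vs \<noteq> Red"
    then show "let j = count_list us Blue + count_list us Black in
        us \<noteq> [] \<and> (last us = Blue \<longrightarrow> q \<le> j) \<and> (last us = Black \<longrightarrow> q \<le> j - 1)"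
      using new[unfolded red_runs_ok_def, rule_format,
          of us q "vs @ t # replicate r Red"] t
      by (cases vs) auto
  qed
  show ?bound
  proof (cases "r = 0")
    case False
    then show ?thesis
      using new[unfolded red_runs_ok_def, rule_format, of "ts @ [t]" r "[]"] t
      by (cases t) (auto simp: Let_def)
  qed simp
next
  assume "red_runs_ok ts \<and> ?bound"
  then have old: "red_runs_ok ts" and bound: ?bound
    by auto
  show "red_runs_ok ?new"
    unfolding red_runs_ok_def
  proof (intro allI impI, elim conjE)
    fix us q vs
    assume eq: "?new = us @ replicate q Red @ vs" and q: "q > 0"
      and us: "us = [] \<or> last us \<noteq> Red" and vs: "vs = [] \<or> hd vs \<noteq> Red"
    show "let j = count_list us Blue + count_list us Black in
        us \<noteq> [] \<and> (last us = Blue \<longrightarrow> q \<le> j) \<and> (last us = Black \<longrightarrow> q \<le> j - 1)"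
    proof (cases vs)
      case Nil
      have "us \<noteq> []"
      proof
        assume "us = []"
        then have "t \<in> set (replicate q Red)"
          using eq Nil by (metis append_Nil append_Nil2 in_set_conv_decomp)
        with t show False by simp
      qed
      then obtain us' x where x: "us = us' @ [x]" "x \<noteq> Red"
        using us by (metis last_snoc rev_exhaust)
      have "ts = us' \<and> t = x \<and> r = q"
        by (rule last_block_unique) (use eq Nil x t in auto)
      then show ?thesis
        using bound x(1) t by (cases t) (auto simp: Let_def)
    next
      case (Cons y ys)
      have "vs \<noteq> replicate (length vs) Red"
        using vs Cons by auto
      then obtain vs' x p where x: "x \<noteq> Red" "vs = vs' @ x # replicate p Red"
        using last_block_exists by metis
      have "ts = us @ replicate q Red @ vs' \<and> t = x \<and> r = p"
        by (rule last_block_unique) (use eq x t in auto)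
      moreover have "vs' = [] \<or> hd vs' \<noteq> Red"
        using vs x by (cases vs') auto
      ultimately show ?thesis
        using old q us unfolding red_runs_ok_def by blast
    qed
  qed
qed

lemma red_runs_ok_Nil: "red_runs_ok []"
  by (auto simp: red_runs_ok_def)

lemma not_red_runs_ok_all_red:
  assumes "r > 0"
  shows "\<not> red_runs_ok (replicate r Red)"
proof
  assume "red_runs_ok (replicate r Red)"
  from this[unfolded red_runs_ok_def, rule_format, of "[]" r "[]"] assms show False
    by (simp add: Let_def)
qed

text \<open>A black rectangle has length 2 and is counted once among the red squares and black
  rectangles and once among the blue squares and black rectangles, so the two exact counts
  determine the length of the board.\<close>

lemma tilings_Suc_iff:
  "ts \<in> tilings (Suc m) k \<longleftrightarrow>
     count_list ts Red + count_list ts Black = k \<and>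
     count_list ts Blue + count_list ts Black = m \<and> red_runs_ok ts"
proof -
  have "sum_list (map tile_length ts) =
      count_list ts Blue + count_list ts Red + 2 * count_list ts Black"
  proof (induction ts)
    case (Cons t ts)
    then show ?case by (cases t) auto
  qed simp
  then show ?thesis
    by (auto simp: tilings_def)
qed

lemma count_list_replicate: "count_list (replicate r x) y = (if x = y then r else 0)"
  by (induction r) auto

lemma append_block_in_tilings_iff:
  assumes "b \<longrightarrow> c > 0"
  shows "ts @ block (c, b) \<in> tilings (Suc (Suc m)) k \<longleftrightarrow>
    (c, b) \<in> choices (Suc m) k \<and> ts \<in> tilings (Suc m) (k - c)"
proof (cases b)
  case True
  then obtain d where "c = Suc d"
    using assms by (auto elim: less_natE)
  with True show ?thesis
    by (auto simp: tilings_Suc_iff choices_def red_runs_ok_append count_list_replicate Let_def)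
next
  case False
  then show ?thesis
    by (auto simp: tilings_Suc_iff choices_def red_runs_ok_append count_list_replicate Let_def)
qed

lemma tilings_one: "tilings (Suc 0) k = (if k = 0 then {[]} else {})"
proof -
  have "ts = []" if "ts \<in> tilings (Suc 0) k" for ts
  proof -
    from that have *: "count_list ts Blue = 0" "count_list ts Black = 0" "red_runs_ok ts"
      by (auto simp: tilings_Suc_iff)
    then have "x = Red" if "x \<in> set ts" for x
      using that by (cases x) (auto simp: count_list_0_iff)
    then have "ts = replicate (length ts) Red"
      by (metis replicate_length_same)
    with *(3) show ?thesis
      by (metis length_greater_0_conv not_red_runs_ok_all_red)
  qed
  moreover have "[] \<in> tilings (Suc 0) k \<longleftrightarrow> k = 0"
    by (auto simp: tilings_Suc_iff red_runs_ok_Nil)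
  ultimately show ?thesis
    by auto
qed

lemma tilings_decompose:
  "tilings (Suc (Suc m)) k = (\<lambda>(p, ts). ts @ block p) `
    (SIGMA p : choices (Suc m) k. tilings (Suc m) (k - fst p))" (is "?L = ?f ` ?S")
proof
  show "?f ` ?S \<subseteq> ?L"
    using append_block_in_tilings_iff by (auto simp: choices_def simp del: block.simps)
  show "?L \<subseteq> ?f ` ?S"
  proof
    fix ts assume ts: "ts \<in> ?L"
    have "ts \<noteq> replicate (length ts) Red"
    proof
      assume all_red: "ts = replicate (length ts) Red"
      have "count_list ts Blue + count_list ts Black = 0"
        by (subst (1 2) all_red) (simp add: count_list_replicate)
      with ts show False
        by (simp add: tilings_Suc_iff)
    qed
    then obtain us t r where t: "t \<noteq> Red" "ts = us @ t # replicate r Red"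
      using last_block_exists by metis
    obtain c b where cb: "b \<longrightarrow> c > 0" "t # replicate r Red = block (c, b)"
    proof (cases t)
      case Blue
      then show ?thesis using that[of False r] by simp
    next
      case Black
      then show ?thesis using that[of True "Suc r"] by simp
    qed (use t in simp)
    with ts t have "((c, b), us) \<in> ?S"
      by (simp add: append_block_in_tilings_iff del: block.simps)
    then show "ts \<in> ?f ` ?S"
      by (rule rev_image_eqI) (use t cb in simp)
  qed
qed

lemma inj_on_append_block:
  "inj_on (\<lambda>(p, ts). ts @ block p) (SIGMA p : choices m k. S p)"
proof -
  have eq: "ts = ts' \<and> c = c' \<and> b = b'"
    if *: "(c, b) \<in> choices m k" "(c', b') \<in> choices m k"
      "ts @ block (c, b) = ts' @ block (c', b')" for c b ts c' b' ts'
  proof -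
    have block: "block (c, b) =
        (if b then Black else Blue) # replicate (if b then c - 1 else c) Red" for c b
      by simp
    have "ts = ts' \<and> (if b then Black else Blue) = (if b' then Black else Blue) \<and>
        (if b then c - 1 else c) = (if b' then c' - 1 else c')"
      by (rule last_block_unique) (use *(3)[unfolded block] in auto)
    with *(1,2) show ?thesis
      by (auto simp: choices_def split: if_splits)
  qed
  show ?thesis
    by (rule inj_onI) (auto dest: eq simp del: block.simps)
qed

lemma card_tilings_recurrence:
  "card (tilings (Suc (Suc m)) k) =
     (\<Sum>(c, b)\<in>choices (Suc m) k. card (tilings (Suc m) (k - c)))"
  unfolding tilings_decompose card_image[OF inj_on_append_block]
  by (subst card_SigmaI) (auto simp: finite_choices finite_tilings intro!: sum.cong)


section \<open>Comparison of the two counts\<close>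

lemma card_over_words:
  assumes "finite A" "card A = Suc m"
  shows "card (over_words A k) = card (tilings (Suc m) k)"
  using assms
proof (induction m arbitrary: A k)
  case 0
  \<comment> \<open>A single letter leaves no choice: it exceeds nothing and cannot be overlined.\<close>
  have "choices 0 k = {(0, False)}"
    by (auto simp: choices_def)
  then have "card (over_words A k) = (if k = 0 then 1 else 0)"
    using card_over_words_recurrence[OF 0, of "\<lambda>l. if l = 0 then 1 else 0" k]
    by (auto simp: over_words_empty)
  then show ?case
    by (simp add: tilings_one)
next
  case (Suc m)
  show ?case
    unfolding card_tilings_recurrence
    by (rule card_over_words_recurrence) (use Suc in auto)
qed

theorem corollary3p6:
  fixes n k :: nat
  assumes "n \<ge> 1"
  shows "over_mahonian n k = card (tilings n k)"
  using card_over_words[of "{1..n}" "n - 1" k] assms by (simp add: over_mahonian_eq)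

end
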